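(* The generating functions $l(N,z), s(N,z), r(N,z)$ of the Grover walk with absorbing boundaries at $-1$ and $N$ satisfy, for every integer $N\ge1$, $$l(N,z)=\frac{-z+z^2}{3+z-(2z+2z^2)\,r(N-1,z)},$$ $$s(N,z)=\frac{2z-2z^2\,r(N-1,z)}{3+z-(2z+2z^2)\,r(N-1,z)},$$ $$r(N,z)=\frac{2z+2z^2-(z^2+3z^3)\,r(N-1,z)}{3+z-(2z+2z^2)\,r(N-1,z)},$$ with initial conditions $l(0,z)=s(0,z)=r(0,z)=0$.
   Context: The Grover walk acts on the Hilbert space $\mathcal H=\ell^2(\mathbb Z)\otimes\mathbb C^3$ with orthonormal basis $|m,c\rangle=|m\rangle\otimes|c\rangle$, $m\in\mathbb Z$, $c\in\{L,S,R\}$. The evolution operator is $U=\mathrm{Sh}\cdot(I\otimes G)$, where, in the ordered basis $(L,S,R)$, $G=\frac13\begin{pmatrix}-1&2&2\\2&-1&2\\2&2&-1\end{pmatrix}$, and the shift is $\mathrm{Sh}|m,L\rangle=|m-1,L\rangle$, $\mathrm{Sh}|m,S\rangle=|m,S\rangle$, $\mathrm{Sh}|m,R\rangle=|m+1,R\rangle$. For $n\in\mathbb Z$, $\Pi_{yes}^{n}=|n\rangle\langle n|\otimes I$ and $\Pi_{no}^{n}=I-\Pi_{yes}^{n}$. For $N\ge1$ and $c=L,S,R$ respectively, $l(N,z),s(N,z),r(N,z)$ are the power series $$\sum_{t\ge1}\langle-1,L|U(\Pi_{no}^{N}\Pi_{no}^{-1}U)^{t-1}|0,c\rangle z^t .$$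 For $N=0$ they are set equal to $0$ by convention. *)

theory Defs
  imports "HOL-Analysis.Analysis" "HOL-Computational_Algebra.Formal_Power_Series"
begin

datatype coin = L | S | R

lemma UNIV_coin: "UNIV = {L, S, R}"
  using coin.exhaust by auto

instance coin :: finite
  by standard (simp add: UNIV_coin)

text \<open>The space $\ell^2(Z) \otimes C^3$ is rendered as the square-summable functions from the
  integers to $C^3$; the operators below are given pointwise on all functions and leave
  the subspace \<open>ell2\<close> invariant.\<close>

type_synonym state = "int \<Rightarrow> complex ^ coin"

definition ell2 :: "state set" where
  "ell2 = {\<psi>. (\<lambda>m. (norm (\<psi> m))\<^sup>2) summable_on UNIV}"

definition braket :: "state \<Rightarrow> state \<Rightarrow> complex" where
  "braket \<phi> \<psi> = (\<Sum>\<^sub>\<infinity>m. \<Sum>c\<in>UNIV. cnj (\<phi> m $ c) * \<psi> m $ c)"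

definition ket :: "int \<Rightarrow> coin \<Rightarrow> state" where
  "ket m c = (\<lambda>n. if n = m then axis c 1 else 0)"

definition grover :: "complex ^ coin ^ coin" where
  "grover = (\<chi> i j. if i = j then - 1 / 3 else 2 / 3)"

definition coin_op :: "state \<Rightarrow> state" where
  "coin_op \<psi> = (\<lambda>m. grover *v \<psi> m)"

text \<open>The amplitude arriving at \<open>m\<close> with chirality \<open>L\<close> comes from \<open>m + 1\<close>; see \<open>shift_ket\<close>
  for the action on basis vectors.\<close>

definition shift :: "state \<Rightarrow> state" where
  "shift \<psi> = (\<lambda>m. \<chi> c. case c of L \<Rightarrow> \<psi> (m + 1) $ L | S \<Rightarrow> \<psi> m $ S | R \<Rightarrow> \<psi> (m - 1) $ R)"

definition walk :: "state \<Rightarrow> state" where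
  "walk = shift \<circ> coin_op"

definition proj_yes :: "int \<Rightarrow> state \<Rightarrow> state" where
  "proj_yes n \<psi> = (\<lambda>m. if m = n then \<psi> m else 0)"

definition proj_no :: "int \<Rightarrow> state \<Rightarrow> state" where
  "proj_no n \<psi> = (\<lambda>m. \<psi> m - proj_yes n \<psi> m)"

text \<open>Generating function, as a formal power series, of the amplitudes of first absorption
  at \<open>-1\<close> when started in \<open>ket 0 c\<close> with absorbing boundaries at \<open>-1\<close> and \<open>N\<close>.\<close>

definition absorb_gf :: "nat \<Rightarrow> coin \<Rightarrow> complex fps" where
  "absorb_gf N c =
    (if N = 0 then 0
     else Abs_fps (\<lambda>t. if t = 0 then 0
       else braket (ket (- 1) L)
         (walk (((proj_no (int N) \<circ> proj_no (- 1) \<circ> walk) ^^ (t - 1)) (ket 0 c)))))"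

definition l_gf :: "nat \<Rightarrow> complex fps" where "l_gf N = absorb_gf N L"
definition s_gf :: "nat \<Rightarrow> complex fps" where "s_gf N = absorb_gf N S"
definition r_gf :: "nat \<Rightarrow> complex fps" where "r_gf N = absorb_gf N R"

lemma shift_ket:
  "shift (ket m L) = ket (m - 1) L"
  "shift (ket m S) = ket m S"
  "shift (ket m R) = ket (m + 1) R"
  by (auto simp: shift_def ket_def axis_def fun_eq_iff vec_eq_iff split: coin.split)

lemma coin_op_ket:
  "coin_op (ket m c) = (\<lambda>n. \<Sum>d\<in>UNIV. (if c = d then - 1 / 3 else 2 / 3) *s ket m d n)"
  by (cases c) (auto simp: coin_op_def ket_def grover_def fun_eq_iff vec_eq_iff axis_def
      matrix_vector_mult_def UNIV_coin, (metis coin.exhaust)+)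

lemma proj_yes_ket: "proj_yes n (ket m c) = (if m = n then ket m c else (\<lambda>_. 0))"
  by (auto simp: proj_yes_def ket_def fun_eq_iff)

lemma braket_ket: "braket (ket m c) \<psi> = \<psi> m $ c"
proof -
  have "(\<Sum>\<^sub>\<infinity>n. \<Sum>d\<in>UNIV. cnj (ket m c n $ d) * \<psi> n $ d) =
        (\<Sum>\<^sub>\<infinity>n\<in>{m}. \<Sum>d\<in>UNIV. cnj (ket m c n $ d) * \<psi> n $ d)"
    by (rule infsum_cong_neutral) (auto simp: ket_def)
  also have "\<dots> = \<psi> m $ c"
    by (cases c) (simp_all add: ket_def axis_def UNIV_coin)
  finally show ?thesis by (simp add: braket_def)
qed

lemma braket_ket_ket: "braket (ket m c) (ket n d) = (if m = n \<and> c = d then 1 else 0)"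
  unfolding braket_ket by (auto simp: ket_def axis_def)

lemma ell2_ket: "ket m c \<in> ell2"
proof -
  have "(\<lambda>n. (norm (ket m c n))\<^sup>2) summable_on {m}" by simp
  then have "(\<lambda>n. (norm (ket m c n))\<^sup>2) summable_on UNIV"
    by (rule summable_on_cong_neutral[THEN iffD1, rotated -1]) (auto simp: ket_def)
  then show ?thesis by (simp add: ell2_def)
qed

lemma norm_coin: "(norm (x :: complex ^ coin))\<^sup>2 =
    (norm (x $ L))\<^sup>2 + (norm (x $ S))\<^sup>2 + (norm (x $ R))\<^sup>2"
  by (simp add: norm_vec_def L2_set_def UNIV_coin add.assoc)

lemma norm_grover: "norm (grover *v x) = norm x"
proof -
  have comps:
    "(grover *v x) $ L = (2 * x $ S + 2 * x $ R - x $ L) / 3"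
    "(grover *v x) $ S = (2 * x $ L + 2 * x $ R - x $ S) / 3"
    "(grover *v x) $ R = (2 * x $ L + 2 * x $ S - x $ R) / 3"
    by (simp_all add: grover_def matrix_vector_mult_def UNIV_coin field_simps)
  have "(norm (grover *v x))\<^sup>2 = (norm x)\<^sup>2"
    unfolding norm_coin comps cmod_power2 by (simp add: power2_eq_square field_simps)
  then show ?thesis by simp
qed

lemma ell2_coin_op: "\<psi> \<in> ell2 \<Longrightarrow> coin_op \<psi> \<in> ell2"
  by (simp add: ell2_def coin_op_def norm_grover)

lemma ell2_proj_yes: "\<psi> \<in> ell2 \<Longrightarrow> proj_yes n \<psi> \<in> ell2"
  unfolding ell2_def mem_Collect_eq
  by (erule summable_on_comparison_test) (auto simp: proj_yes_def)

lemma ell2_proj_no: "\<psi> \<in> ell2 \<Longrightarrow> proj_no n \<psi> \<in> ell2"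
  unfolding ell2_def mem_Collect_eq
  by (erule summable_on_comparison_test) (auto simp: proj_no_def proj_yes_def)

lemma ell2_shift:
  assumes "\<psi> \<in> ell2" shows "shift \<psi> \<in> ell2"
proof -
  have comp: "(\<lambda>m. (norm (\<psi> m $ c))\<^sup>2) summable_on UNIV" for c
    using assms unfolding ell2_def mem_Collect_eq
    by (rule summable_on_comparison_test) (auto intro: power_mono Finite_Cartesian_Product.norm_nth_le)
  have tr: "(\<lambda>m. (norm (\<psi> (m + k) $ c))\<^sup>2) summable_on UNIV" for c k
    using summable_on_reindex_bij_betw[of "\<lambda>m. m + k" UNIV UNIV "\<lambda>m. (norm (\<psi> m $ c))\<^sup>2"]
      comp[of c] by (simp add: bij_plus_right)
  show ?thesis
    using summable_on_add[OF summable_on_add[OF tr[where c = L and k = 1] comp[of S]]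
        tr[where c = R and k = "- 1"]]
    by (simp add: ell2_def shift_def norm_coin)
qed

lemma ell2_walk: "\<psi> \<in> ell2 \<Longrightarrow> walk \<psi> \<in> ell2"
  by (simp add: walk_def ell2_shift ell2_coin_op)

end

theory Submission
  imports Defs
begin

text \<open>Conditioning on the first step gives a linear system for the generating functions of absorption
  at \<open>-1\<close> from all sites \<open>0 \<le> m < N\<close>, with boundary value \<open>1\<close> at \<open>-1\<close> and \<open>0\<close> at \<open>N\<close>. Every equation
  carries a factor \<open>X\<close> on its right-hand side, so the boundary values determine the solution. Hence
  the solution for \<open>N\<close> shifted by one site is the solution for \<open>N - 1\<close> times the value at \<open>(0, L)\<close>:
  a walker at \<open>1\<close> has to reach \<open>0\<close> first, and it arrives there with chirality \<open>L\<close>. Substituting this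
  at site \<open>0\<close> leaves three linear equations for \<open>l\<close>, \<open>s\<close>, \<open>r\<close>.\<close>

definition absorb_step :: "int \<Rightarrow> state \<Rightarrow> state" where
  "absorb_step N = proj_no N \<circ> proj_no (- 1) \<circ> walk"

text \<open>\<open>t\<close> counts the steps before the absorbing one, so this is the coefficient
  of \<open>z^(t+1)\<close>. The last \<open>walk\<close> stays unprojected, since
  \<open>proj_no (- 1)\<close> would erase the amplitude that is read off.\<close>

definition absorb_amp :: "int \<Rightarrow> nat \<Rightarrow> state \<Rightarrow> complex" where
  "absorb_amp N t \<psi> = walk ((absorb_step N ^^ t) \<psi>) (- 1) $ L"

lemma walk_nth:
  "walk \<psi> m $ L = (2 * \<psi> (m + 1) $ S + 2 * \<psi> (m + 1) $ R - \<psi> (m + 1) $ L) / 3"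
  "walk \<psi> m $ S = (2 * \<psi> m $ L + 2 * \<psi> m $ R - \<psi> m $ S) / 3"
  "walk \<psi> m $ R = (2 * \<psi> (m - 1) $ L + 2 * \<psi> (m - 1) $ S - \<psi> (m - 1) $ R) / 3"
  by (simp_all add: walk_def shift_def coin_op_def grover_def matrix_vector_mult_def UNIV_coin
      field_simps)

lemma coin_vec_eq_iff: "(x :: 'a ^ coin) = y \<longleftrightarrow> x $ L = y $ L \<and> x $ S = y $ S \<and> x $ R = y $ R"
  unfolding vec_eq_iff ball_UNIV[symmetric] UNIV_coin by simp

text \<open>Three summands, because one step turns a ket into a combination of three kets.\<close>

lemma walk_linear:
  "walk (\<lambda>k. a *s u k + b *s v k + c *s w k) = (\<lambda>k. a *s walk u k + b *s walk v k + c *s walk w k)"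
  by (simp add: fun_eq_iff coin_vec_eq_iff walk_nth add_divide_distrib diff_divide_distrib algebra_simps)

lemma absorb_step_linear:
  "absorb_step N (\<lambda>k. a *s u k + b *s v k + c *s w k) =
    (\<lambda>k. a *s absorb_step N u k + b *s absorb_step N v k + c *s absorb_step N w k)"
  by (auto simp: absorb_step_def walk_linear proj_no_def proj_yes_def fun_eq_iff)

lemma absorb_amp_Suc: "absorb_amp N (Suc t) \<psi> = absorb_amp N t (absorb_step N \<psi>)"
  by (simp add: absorb_amp_def funpow_swap1)

lemma absorb_amp_linear:
  "absorb_amp N t (\<lambda>k. a *s u k + b *s v k + c *s w k) =
    a * absorb_amp N t u + b * absorb_amp N t v + c * absorb_amp N t w"
proof (induction t arbitrary: u v w)
  case 0
  then show ?case by (simp add: absorb_amp_def walk_linear)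
next
  case (Suc t)
  then show ?case by (simp add: absorb_amp_Suc absorb_step_linear)
qed

lemma walk_ket:
  "walk (ket m c) = (\<lambda>k. grover $ L $ c *s ket (m - 1) L k + grover $ S $ c *s ket m S k
     + grover $ R $ c *s ket (m + 1) R k)"
proof
  fix k
  consider "k = m - 1" | "k = m" | "k = m + 1" | "k \<noteq> m - 1" "k \<noteq> m" "k \<noteq> m + 1"
    by blast
  then show "walk (ket m c) k = grover $ L $ c *s ket (m - 1) L k + grover $ S $ c *s ket m S k
     + grover $ R $ c *s ket (m + 1) R k"
    by cases (cases c; simp add: coin_vec_eq_iff walk_nth ket_def axis_def grover_def)+
qed

text \<open>The projections appear as vanishing coefficients, which keeps the three-ket form that
  \<open>absorb_amp_linear\<close> expects.\<close>

lemma absorb_step_ket: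
  "absorb_step N (ket m c) =
    (\<lambda>k. (if m - 1 = - 1 \<or> m - 1 = N then 0 else grover $ L $ c) *s ket (m - 1) L k
       + (if m = - 1 \<or> m = N then 0 else grover $ S $ c) *s ket m S k
       + (if m + 1 = - 1 \<or> m + 1 = N then 0 else grover $ R $ c) *s ket (m + 1) R k)"
proof
  fix k
  show "absorb_step N (ket m c) k =
      (if m - 1 = - 1 \<or> m - 1 = N then 0 else grover $ L $ c) *s ket (m - 1) L k
       + (if m = - 1 \<or> m = N then 0 else grover $ S $ c) *s ket m S k
       + (if m + 1 = - 1 \<or> m + 1 = N then 0 else grover $ R $ c) *s ket (m + 1) R k"
  proof (cases "k = - 1 \<or> k = N")
    case True
    then show ?thesis by (auto simp: absorb_step_def proj_no_def proj_yes_def ket_def)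
  next
    case False
    then have "absorb_step N (ket m c) k = walk (ket m c) k"
      by (auto simp: absorb_step_def proj_no_def proj_yes_def)
    with False show ?thesis
      unfolding walk_ket by (auto simp: ket_def)
  qed
qed

lemma absorb_amp_0_ket: "absorb_amp N 0 (ket m c) = (if m = 0 then grover $ L $ c else 0)"
  by (cases c) (auto simp: absorb_amp_def walk_nth ket_def axis_def grover_def)

text \<open>At the two boundary sites boundary values replace walk amplitudes: a walker at
  \<open>-1\<close> has been absorbed there, one at \<open>N\<close> is lost.\<close>

definition site_gf :: "int \<Rightarrow> int \<Rightarrow> coin \<Rightarrow> complex fps" where
  "site_gf N m c =
    (if m = - 1 then 1 else if m = N then 0
     else Abs_fps (\<lambda>t. if t = 0 then 0 else absorb_amp N (t - 1) (ket m c)))"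

text \<open>Stated for arbitrary families, since it is also applied to a translate and a multiple of
  \<open>site_gf\<close>.\<close>

definition first_step_at :: "(int \<Rightarrow> coin \<Rightarrow> complex fps) \<Rightarrow> int \<Rightarrow> bool" where
  "first_step_at F m \<longleftrightarrow> (\<forall>c. F m c =
     fps_X * (fps_const (grover $ L $ c) * F (m - 1) L + fps_const (grover $ S $ c) * F m S
       + fps_const (grover $ R $ c) * F (m + 1) R))"

lemma first_step_atD:
  "first_step_at F m \<Longrightarrow> F m c =
     fps_X * (fps_const (grover $ L $ c) * F (m - 1) L + fps_const (grover $ S $ c) * F m S
       + fps_const (grover $ R $ c) * F (m + 1) R)"
  unfolding first_step_at_def by blast

lemma site_gf_first_step:
  assumes "0 \<le> m" "m < N"
  shows "first_step_at (site_gf N) m"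
  unfolding first_step_at_def
proof (intro allI fps_ext)
  fix c n
  show "fps_nth (site_gf N m c) n =
    fps_nth (fps_X * (fps_const (grover $ L $ c) * site_gf N (m - 1) L
      + fps_const (grover $ S $ c) * site_gf N m S
      + fps_const (grover $ R $ c) * site_gf N (m + 1) R)) n"
  proof (cases n)
    case 0
    then show ?thesis using assms by (simp add: site_gf_def)
  next
    case (Suc t)
    \<comment> \<open>For \<open>t = 0\<close> the only contribution is the boundary value
      \<open>1\<close> at \<open>-1\<close>, reached from \<open>m = 0\<close>. For larger
      \<open>t\<close> the boundary values have zero coefficients, matching the amplitudes cut off
      in \<open>absorb_step_ket\<close>.\<close>
    then show ?thesis using assms
      by (cases t) (auto simp: site_gf_def absorb_amp_0_ket absorb_amp_Suc absorb_step_ket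
          absorb_amp_linear)
  qed
qed

lemma first_step_at_unique:
  assumes "\<And>m. 0 \<le> m \<Longrightarrow> m < N \<Longrightarrow> first_step_at F m"
    and "\<And>m. 0 \<le> m \<Longrightarrow> m < N \<Longrightarrow> first_step_at H m"
    and "F (- 1) L = H (- 1) L" and "F N R = H N R" and "0 \<le> m" "m < N"
  shows "F m c = H m c"
proof (rule fps_ext)
  fix n
  show "fps_nth (F m c) n = fps_nth (H m c) n"
    using assms(5,6)
  \<comment> \<open>Site and coin vary because coefficient \<open>Suc n\<close> at one site involves
    coefficient \<open>n\<close> at both neighbours.\<close>
  proof (induction n arbitrary: m c)
    case 0
    then show ?case
      using assms(1,2)[of m, THEN first_step_atD, of c] by simp
  next
    case (Suc n)
    have "fps_nth (F (m - 1) L) n = fps_nth (H (m - 1) L) n"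
      using Suc assms(3) by (cases "m = 0") simp_all
    moreover have "fps_nth (F m S) n = fps_nth (H m S) n"
      using Suc by simp
    moreover have "fps_nth (F (m + 1) R) n = fps_nth (H (m + 1) R) n"
      using Suc assms(4) by (cases "m + 1 = N") auto
    moreover have "F m c = fps_X * (fps_const (grover $ L $ c) * F (m - 1) L
        + fps_const (grover $ S $ c) * F m S + fps_const (grover $ R $ c) * F (m + 1) R)"
      "H m c = fps_X * (fps_const (grover $ L $ c) * H (m - 1) L
        + fps_const (grover $ S $ c) * H m S + fps_const (grover $ R $ c) * H (m + 1) R)"
      using Suc.prems assms(1,2)[THEN first_step_atD] by blast+
    ultimately show ?case by simp
  qed
qed

lemma site_gf_shift:
  assumes "0 \<le> m" "m < N - 1"
  shows "site_gf N (m + 1) c = site_gf (N - 1) m c * site_gf N 0 L"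
proof -
  let ?F = "\<lambda>m. site_gf N (m + 1)" and ?H = "\<lambda>m c. site_gf (N - 1) m c * site_gf N 0 L"
  have "first_step_at ?F m" if "0 \<le> m" "m < N - 1" for m
  proof -
    have "first_step_at (site_gf N) (m + 1)"
      using that by (intro site_gf_first_step) auto
    then show ?thesis
      unfolding first_step_at_def add_diff_cancel_right' diff_add_cancel .
  qed
  moreover have "first_step_at ?H m" if m: "0 \<le> m" "m < N - 1" for m
    unfolding first_step_at_def
  proof
    fix c
    have "site_gf (N - 1) m c = fps_X * (fps_const (grover $ L $ c) * site_gf (N - 1) (m - 1) L
        + fps_const (grover $ S $ c) * site_gf (N - 1) m S
        + fps_const (grover $ R $ c) * site_gf (N - 1) (m + 1) R)"
      using site_gf_first_step[of m "N - 1", THEN first_step_atD] m by blast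
    then show "?H m c = fps_X * (fps_const (grover $ L $ c) * ?H (m - 1) L
        + fps_const (grover $ S $ c) * ?H m S + fps_const (grover $ R $ c) * ?H (m + 1) R)"
      by (simp only: algebra_simps)
  qed
  \<comment> \<open>On the left both sides are \<open>site_gf N 0 L\<close>, as the boundary value
    of \<open>site_gf (N - 1)\<close> is \<open>1\<close> there; on the right both are
    \<open>0\<close>.\<close>
  moreover have "?F (- 1) L = ?H (- 1) L" "?F (N - 1) R = ?H (N - 1) R"
    using assms by (simp_all add: site_gf_def)
  ultimately show ?thesis
    using first_step_at_unique[of "N - 1" ?F ?H] assms by blast
qed

lemma absorb_gf_eq_site_gf: "N \<ge> 1 \<Longrightarrow> absorb_gf N c = site_gf (int N) 0 c"
  by (simp add: absorb_gf_def site_gf_def braket_ket absorb_amp_def absorb_step_def cong: if_cong)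

lemma absorb_gf_first_step:
  assumes "N \<ge> 1"
  shows "absorb_gf N c = fps_X * (fps_const (grover $ L $ c) + fps_const (grover $ S $ c) * s_gf N
    + fps_const (grover $ R $ c) * (r_gf (N - 1) * l_gf N))"
proof -
  have "site_gf (int N) 1 R = r_gf (N - 1) * l_gf N"
  \<comment> \<open>For \<open>N = 1\<close> site \<open>1\<close> is the right boundary with value
    \<open>0\<close>, which agrees with the convention \<open>r_gf 0 = 0\<close>.\<close>
  proof (cases "N = 1")
    case True
    then show ?thesis by (simp add: site_gf_def r_gf_def absorb_gf_def)
  next
    case False
    then show ?thesis using assms site_gf_shift[of 0 "int N" R]
      by (simp add: r_gf_def l_gf_def absorb_gf_eq_site_gf)
  qed
  moreover have "site_gf (int N) (- 1) L = 1"
    by (simp add: site_gf_def)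
  ultimately show ?thesis
    using site_gf_first_step[of 0 "int N", THEN first_step_atD, of c] assms
    by (simp add: absorb_gf_eq_site_gf s_gf_def)
qed

lemma fps_eq_divideI:
  fixes f g h :: "'a :: field fps"
  assumes "g \<noteq> 0" "f * g = h"
  shows "f = h / g"
  using assms by auto

theorem theorem3:
  "(\<forall>N \<ge> 1.
     l_gf N = (- fps_X + fps_X ^ 2) /
       (3 + fps_X - (2 * fps_X + 2 * fps_X ^ 2) * r_gf (N - 1)) \<and>
     s_gf N = (2 * fps_X - 2 * fps_X ^ 2 * r_gf (N - 1)) /
       (3 + fps_X - (2 * fps_X + 2 * fps_X ^ 2) * r_gf (N - 1)) \<and>
     r_gf N = (2 * fps_X + 2 * fps_X ^ 2 - (fps_X ^ 2 + 3 * fps_X ^ 3) * r_gf (N - 1)) /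
       (3 + fps_X - (2 * fps_X + 2 * fps_X ^ 2) * r_gf (N - 1))) \<and>
   l_gf 0 = 0 \<and> s_gf 0 = 0 \<and> r_gf 0 = 0"
proof (intro conjI allI impI)
  fix N :: nat assume N: "N \<ge> 1"
  define X :: "complex fps" where "X = fps_X"
  define \<rho> l s r where "\<rho> = r_gf (N - 1)" "l = l_gf N" "s = s_gf N" "r = r_gf N"
  note defs = this
  define D where "D = 3 + X - (2 * X + 2 * X ^ 2) * \<rho>"
  define u v :: "complex fps" where "u = fps_const (- 1 / 3)" "v = fps_const (2 / 3)"
  note uv = this
  \<comment> \<open>These relations let \<open>algebra\<close> clear the fractions of the Grover
    matrix.\<close>
  have three: "3 * u = - 1" "3 * v = 2"
    unfolding uv numeral_fps_const fps_const_mult by (simp flip: fps_const_neg, simp)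
  have "absorb_gf N c = X * ((if L = c then u else v) + (if S = c then u else v) * s
      + (if R = c then u else v) * (\<rho> * l))" for c
    using absorb_gf_first_step[OF N, of c]
    by (simp add: grover_def X_def uv defs)
  then have "absorb_gf N L = X * (u + v * s + v * (\<rho> * l))"
    "absorb_gf N S = X * (v + u * s + v * (\<rho> * l))"
    "absorb_gf N R = X * (v + v * s + u * (\<rho> * l))"
    by simp_all
  moreover have "absorb_gf N L = l" "absorb_gf N S = s" "absorb_gf N R = r"
    by (simp_all add: defs l_gf_def s_gf_def r_gf_def)
  ultimately have eqs: "3 * l = X * (- 1 + 2 * s + 2 * (\<rho> * l))"
    "3 * s = X * (2 - s + 2 * (\<rho> * l))" "3 * r = X * (2 + 2 * s - \<rho> * l)"
    using three by algebra+
  have "fps_nth D 0 = 3"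
    by (simp add: D_def X_def numeral_fps_const)
  then have D: "D \<noteq> 0" by auto
  have "fps_nth (3 + X) 0 = 3" by (simp add: X_def)
  then have "3 + X \<noteq> 0"
    by (metis fps_zero_nth zero_neq_numeral)
  then have nz: "(3 :: complex fps) \<noteq> 0" "3 + X \<noteq> 0"
    by simp_all
  \<comment> \<open>Multiplying the first equation by \<open>3 + X\<close> and replacing
    \<open>(3 + X) * s\<close> by means of the second eliminates \<open>s\<close>; a common factor
    \<open>3\<close> remains.\<close>
  have "3 * (l * D) = 3 * (- X + X ^ 2)"
    using eqs(1,2) unfolding D_def by algebra
  then have l: "l * D = - X + X ^ 2"
    using nz(1) mult_left_cancel by blast
  \<comment> \<open>The second equation reads \<open>(3 + X) * s = 2 * X * (1 + \<rho> * l)\<close>;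
    after multiplication by \<open>D\<close> the known \<open>l * D\<close> is inserted.\<close>
  have "(3 + X) * (s * D) = (3 + X) * (2 * X - 2 * X ^ 2 * \<rho>)"
    using eqs(2) l unfolding D_def by algebra
  then have s: "s * D = 2 * X - 2 * X ^ 2 * \<rho>"
    using nz(2) mult_left_cancel by blast
  have "3 * (r * D) = 3 * (2 * X + 2 * X ^ 2 - (X ^ 2 + 3 * X ^ 3) * \<rho>)"
    using eqs(3) l s unfolding D_def by algebra
  then have r: "r * D = 2 * X + 2 * X ^ 2 - (X ^ 2 + 3 * X ^ 3) * \<rho>"
    using nz(1) mult_left_cancel by blast
  show "l_gf N = (- fps_X + fps_X ^ 2) / (3 + fps_X - (2 * fps_X + 2 * fps_X ^ 2) * r_gf (N - 1))"
    using fps_eq_divideI[OF D l] by (simp only: D_def defs X_def)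
  show "s_gf N = (2 * fps_X - 2 * fps_X ^ 2 * r_gf (N - 1)) /
       (3 + fps_X - (2 * fps_X + 2 * fps_X ^ 2) * r_gf (N - 1))"
    using fps_eq_divideI[OF D s] by (simp only: D_def defs X_def)
  show "r_gf N = (2 * fps_X + 2 * fps_X ^ 2 - (fps_X ^ 2 + 3 * fps_X ^ 3) * r_gf (N - 1)) /
       (3 + fps_X - (2 * fps_X + 2 * fps_X ^ 2) * r_gf (N - 1))"
    using fps_eq_divideI[OF D r] by (simp only: D_def defs X_def)
qed (simp_all add: l_gf_def s_gf_def r_gf_def absorb_gf_def)

end
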